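(* Every nonempty closed monovex subset of $\mathbb{R}^n$ is contractible.
   Context: A set $A \subseteq \mathbb{R}^n$ is called monovex if for every $x,y \in A$ there is a continuous path $\gamma:[0,1]\to A$ with $\gamma(0)=x$, $\gamma(1)=y$, such that each coordinate function $\gamma_i:[0,1]\to\mathbb{R}$, $i=1,\dots,n$, is monotone (nondecreasing or nonincreasing). Coordinates are with respect to the standard basis of $\mathbb{R}^n$. *)

theory Defs
  imports "HOL-Analysis.Analysis"
begin

definition monovex :: "(real ^ 'n) set \<Rightarrow> bool" where
  "monovex A \<longleftrightarrow>
     (\<forall>x\<in>A. \<forall>y\<in>A. \<exists>\<gamma> :: real \<Rightarrow> real ^ 'n.
        continuous_on {0..1} \<gamma> \<and> \<gamma> ` {0..1} \<subseteq> A \<and>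
        \<gamma> 0 = x \<and> \<gamma> 1 = y \<and>
        (\<forall>i. mono_on {0..1} (\<lambda>t. \<gamma> t $ i) \<or> antimono_on {0..1} (\<lambda>t. \<gamma> t $ i)))"

end

theory Submission
  imports Defs
begin

text \<open>
  A closed monovex set \<open>A\<close> is a retract of the whole space. By the intermediate value theorem, two
  points of \<open>A\<close> can be joined inside their bounding box by a point of \<open>A\<close> with any prescribed
  intermediate value of one coordinate. This property passes to open cube neighbourhoods of \<open>A\<close>
  and to intersections with cubes, and it makes open-graph set-valued maps admit continuous
  selections: select the coordinates one after another, each time choosing from an interval by a
  partition of unity. Starting from the identity on the complement of \<open>A\<close>, repeated selection
  halves the distance to \<open>A\<close> (measured relative to the initial one) in each step, moving points by
  a geometrically decreasing amount. The limit, extended by the identity on \<open>A\<close>, is a retraction.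
\<close>

section \<open>Slice convexity and its permanence properties\<close>

text \<open>This keeps only single intermediate points from monovexity and no path, which makes it
  easy to pass on to thickenings and to intersections with cubes. \<open>closed_segment\<close> on
  reals is the interval between its ends in either order.\<close>

definition slice_convex :: "(real ^ 'n) set \<Rightarrow> bool" where
  "slice_convex B \<longleftrightarrow>
     (\<forall>x\<in>B. \<forall>y\<in>B. \<forall>k c. x $ k \<le> c \<and> c \<le> y $ k \<longrightarrow>
        (\<exists>z\<in>B. z $ k = c \<and> (\<forall>i. z $ i \<in> closed_segment (x $ i) (y $ i))))"

text \<open>The point sought lies on the path, and monotonicity keeps all its coordinates between
  the end values.\<close>

lemma monovex_imp_slice_convex:
  assumes "monovex A"
  shows "slice_convex A"
  unfolding slice_convex_def
proof (intro ballI allI impI)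
  fix x y k c
  assume xy: "x \<in> A" "y \<in> A" and c: "x $ k \<le> c \<and> c \<le> y $ k"
  obtain \<gamma> where cont: "continuous_on {0..1::real} \<gamma>" and im: "\<gamma> ` {0..1} \<subseteq> A"
    and ends: "\<gamma> 0 = x" "\<gamma> 1 = y"
    and mono: "\<And>i. mono_on {0..1} (\<lambda>t. \<gamma> t $ i) \<or> antimono_on {0..1} (\<lambda>t. \<gamma> t $ i)"
    using assms xy unfolding monovex_def by meson
  have "continuous_on {0..1} (\<lambda>t. \<gamma> t $ k)"
    by (intro continuous_intros cont)
  then obtain t where t: "0 \<le> t" "t \<le> 1" "\<gamma> t $ k = c"
    using IVT'[of "\<lambda>t. \<gamma> t $ k" 0 c 1] c ends by auto
  have "\<gamma> t $ i \<in> closed_segment (x $ i) (y $ i)" for i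
    using mono[of i]
  proof
    assume "mono_on {0..1} (\<lambda>t. \<gamma> t $ i)"
    then have "\<gamma> 0 $ i \<le> \<gamma> t $ i" "\<gamma> t $ i \<le> \<gamma> 1 $ i"
      using t by (auto simp: monotone_on_def)
    then show ?thesis
      by (auto simp: ends closed_segment_eq_real_ivl)
  next
    assume "antimono_on {0..1} (\<lambda>t. \<gamma> t $ i)"
    then have "\<gamma> 0 $ i \<ge> \<gamma> t $ i" "\<gamma> t $ i \<ge> \<gamma> 1 $ i"
      using t by (auto simp: monotone_on_def)
    then show ?thesis
      by (auto simp: ends closed_segment_eq_real_ivl)
  qed
  with t im show "\<exists>z\<in>A. z $ k = c \<and> (\<forall>i. z $ i \<in> closed_segment (x $ i) (y $ i))"
    by (intro bexI[of _ "\<gamma> t"]) auto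
qed

text \<open>Exchanging \<open>x\<close> and \<open>y\<close> removes the orientation built into the
  definition.\<close>

lemma slice_convex_between:
  assumes "slice_convex B" "x \<in> B" "y \<in> B" "c \<in> closed_segment (x $ k) (y $ k)"
  obtains z where "z \<in> B" "z $ k = c" "\<And>i. z $ i \<in> closed_segment (x $ i) (y $ i)"
proof (cases "x $ k \<le> y $ k")
  case True
  then show ?thesis
    using assms that unfolding slice_convex_def closed_segment_eq_real_ivl
    by (metis atLeastAtMost_iff)
next
  case False
  then have c: "y $ k \<le> c \<and> c \<le> x $ k"
    using assms(4) by (auto simp: closed_segment_eq_real_ivl)
  then obtain z where "z \<in> B" "z $ k = c" "\<forall>i. z $ i \<in> closed_segment (y $ i) (x $ i)"
    using assms(1-3) unfolding slice_convex_def by meson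
  then show ?thesis
    using that by (metis closed_segment_commute)
qed

lemma slice_convex_thicken:
  fixes A :: "(real ^ 'n) set"
  assumes "slice_convex A"
  shows "slice_convex {y. \<exists>a\<in>A. \<forall>i. \<bar>y $ i - a $ i\<bar> < e}"
  unfolding slice_convex_def
proof (intro ballI allI impI)
  fix x y :: "real ^ 'n" and k c
  assume "x \<in> {y. \<exists>a\<in>A. \<forall>i. \<bar>y $ i - a $ i\<bar> < e}" "y \<in> {y. \<exists>a\<in>A. \<forall>i. \<bar>y $ i - a $ i\<bar> < e}"
  then obtain a b where a: "a \<in> A" "\<And>i. \<bar>x $ i - a $ i\<bar> < e"
    and b: "b \<in> A" "\<And>i. \<bar>y $ i - b $ i\<bar> < e"
    by blast
  assume c: "x $ k \<le> c \<and> c \<le> y $ k"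
  \<comment> \<open>\<open>p\<close> is \<open>c\<close> clamped to the segment from
    \<open>a $ k\<close> to \<open>b $ k\<close>. As \<open>c\<close> lies between
    \<open>x $ k\<close> and \<open>y $ k\<close>, it overshoots that segment by less than
    \<open>e\<close>.\<close>
  obtain p where p: "p \<in> closed_segment (a $ k) (b $ k)" "\<bar>c - p\<bar> < e"
  proof (cases "a $ k \<le> b $ k")
    case True
    then show ?thesis
      using c a(2)[of k] b(2)[of k]
      by (intro that[of "max (a $ k) (min c (b $ k))"]) (auto simp: closed_segment_eq_real_ivl)
  next
    case False
    then show ?thesis
      using c a(2)[of k] b(2)[of k]
      by (intro that[of "max (b $ k) (min c (a $ k))"]) (auto simp: closed_segment_eq_real_ivl)
  qed
  obtain w where w: "w \<in> A" "w $ k = p" "\<And>i. w $ i \<in> closed_segment (a $ i) (b $ i)"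
    using slice_convex_between[OF assms a(1) b(1) p(1)] by blast
  \<comment> \<open>Off coordinate \<open>k\<close>, \<open>w\<close> is clamped to the box spanned
    by \<open>x\<close> and \<open>y\<close>. Each \<open>w $ i\<close> is between
    \<open>a $ i\<close> and \<open>b $ i\<close>, so this moves it by less than
    \<open>e\<close>.\<close>
  define z :: "real ^ 'n" where
    "z = (\<chi> i. if i = k then c
               else max (min (x $ i) (y $ i)) (min (w $ i) (max (x $ i) (y $ i))))"
  have "\<bar>z $ i - w $ i\<bar> < e" for i
    using w(2) w(3)[of i] p a(2)[of i] b(2)[of i]
    by (cases "i = k") (auto simp: z_def closed_segment_eq_real_ivl split: if_splits)
  moreover have "z $ i \<in> closed_segment (x $ i) (y $ i)" for i
    using c by (auto simp: z_def closed_segment_eq_real_ivl)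
  moreover have "z $ k = c"
    by (simp add: z_def)
  ultimately show "\<exists>z\<in>{y. \<exists>a\<in>A. \<forall>i. \<bar>y $ i - a $ i\<bar> < e}.
      z $ k = c \<and> (\<forall>i. z $ i \<in> closed_segment (x $ i) (y $ i))"
    using w(1) by blast
qed

text \<open>A cube is a product of intervals, so it contains the box spanned by any two of its
  points.\<close>

lemma slice_convex_Int_cube:
  fixes B :: "(real ^ 'n) set"
  assumes "slice_convex B"
  shows "slice_convex (B \<inter> {y. \<forall>i. \<bar>y $ i - p $ i\<bar> < e})"
  unfolding slice_convex_def
proof (intro ballI allI impI)
  fix x y k c
  assume x: "x \<in> B \<inter> {y. \<forall>i. \<bar>y $ i - p $ i\<bar> < e}"
    and y: "y \<in> B \<inter> {y. \<forall>i. \<bar>y $ i - p $ i\<bar> < e}"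
    and "x $ k \<le> c \<and> c \<le> y $ k"
  then obtain z where z: "z \<in> B" "z $ k = c" "\<And>i. z $ i \<in> closed_segment (x $ i) (y $ i)"
    using assms unfolding slice_convex_def by blast
  have "\<bar>z $ i - p $ i\<bar> < e" for i
  proof -
    have "\<bar>x $ i - p $ i\<bar> < e" "\<bar>y $ i - p $ i\<bar> < e"
      using x y by auto
    with z(3)[of i] show ?thesis
      by (auto simp: closed_segment_eq_real_ivl split: if_splits)
  qed
  with z show "\<exists>z\<in>B \<inter> {y. \<forall>i. \<bar>y $ i - p $ i\<bar> < e}.
      z $ k = c \<and> (\<forall>i. z $ i \<in> closed_segment (x $ i) (y $ i))"
    by blast
qed

section \<open>Continuous selections\<close>

text \<open>This is a selection theorem of Browder type: the open fibres cover \<open>X\<close>, and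
  a partition of unity subordinate to a locally finite refinement averages one constant value per
  member.\<close>

lemma convex_open_fibre_selection:
  fixes G :: "'a::{metric_space,second_countable_topology} \<Rightarrow> 'b::real_normed_vector set"
  assumes ne: "\<And>x. x \<in> X \<Longrightarrow> G x \<noteq> {}"
    and conv: "\<And>x. x \<in> X \<Longrightarrow> convex (G x)"
    and fib: "\<And>t. open {x \<in> X. t \<in> G x}"
  obtains g where "continuous_on X g" "\<And>x. x \<in> X \<Longrightarrow> g x \<in> G x"
proof -
  have "X \<subseteq> \<Union> (range (\<lambda>t. {x \<in> X. t \<in> G x}))"
    using ne by blast
  then obtain \<C> where \<C>: "X \<subseteq> \<Union> \<C>"
      "\<And>U. U \<in> \<C> \<Longrightarrow> open U \<and> (\<exists>T. T \<in> range (\<lambda>t. {x \<in> X. t \<in> G x}) \<and> U \<subseteq> T)"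
    and fin: "\<And>x. x \<in> X \<Longrightarrow> \<exists>V. open V \<and> x \<in> V \<and> finite {U. U \<in> \<C> \<and> (U \<inter> V \<noteq> {})}"
    by (rule paracompact) (use fib in auto)
  have "\<forall>U\<in>\<C>. \<exists>t. U \<subseteq> {x \<in> X. t \<in> G x}"
    using \<C>(2) by blast
  \<comment> \<open>The single value \<open>\<tau> U\<close> serves all points of \<open>U\<close>,
    so near \<open>x\<close> only values from the convex set \<open>G x\<close> get positive weight
    at \<open>x\<close>.\<close>
  then obtain \<tau> where \<tau>: "\<And>U x. U \<in> \<C> \<Longrightarrow> x \<in> U \<Longrightarrow> \<tau> U \<in> G x"
    by (metis (no_types, lifting) bchoice mem_Collect_eq subsetD)
  obtain H :: "'a set \<Rightarrow> 'a \<Rightarrow> real"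
    where H: "\<And>U. U \<in> \<C> \<Longrightarrow> continuous_on X (H U) \<and> (\<forall>x\<in>X. 0 \<le> H U x)"
      and H0: "\<And>x U. \<lbrakk>U \<in> \<C>; x \<in> X; x \<notin> U\<rbrakk> \<Longrightarrow> H U x = 0"
      and H1: "\<And>x. x \<in> X \<Longrightarrow> supp_sum (\<lambda>W. H W x) \<C> = 1"
      and Hfin: "\<And>x. x \<in> X \<Longrightarrow> \<exists>V. open V \<and> x \<in> V \<and> finite {U \<in> \<C>. \<exists>x\<in>V. H U x \<noteq> 0}"
    by (rule subordinate_partition_of_unity[of X \<C>]) (use \<C> fin in auto)
  define g where "g x = supp_sum (\<lambda>U. H U x *\<^sub>R \<tau> U) \<C>" for x
  show ?thesis
  proof (rule that)
    show "continuous_on X g"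
      unfolding continuous_on_eq_continuous_within
    proof
      fix a assume a: "a \<in> X"
      obtain N where N: "open N" "a \<in> N" and finN: "finite {U \<in> \<C>. \<exists>x\<in>N. H U x \<noteq> 0}"
        using Hfin a by blast
      have cont: "continuous (at a within X) (H U)" if "U \<in> \<C>" for U
        using H[OF that] a by (simp add: continuous_on_eq_continuous_within)
      \<comment> \<open>On the neighbourhood \<open>N\<close> the support sum is a finite sum over
        an index set independent of the point.\<close>
      show "continuous (at a within X) g"
      proof (rule continuous_transform_within_openin)
        show "continuous (at a within X)
                (\<lambda>x. \<Sum>U\<in>{U \<in> \<C>. \<exists>x\<in>N. H U x \<noteq> 0}. H U x *\<^sub>R \<tau> U)"
          by (force intro: continuous_intros cont)
        show "openin (top_of_set X) (X \<inter> N)"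
          using N by (simp add: openin_open_Int)
        show "a \<in> X \<inter> N"
          using a N by blast
        show "(\<Sum>U\<in>{U \<in> \<C>. \<exists>x\<in>N. H U x \<noteq> 0}. H U x *\<^sub>R \<tau> U) = g x" if "x \<in> X \<inter> N" for x
          using that by (auto simp: g_def supp_sum_def support_on_def
              intro: sum.mono_neutral_right[OF finN])
      qed
    qed
    show "g x \<in> G x" if "x \<in> X" for x
      unfolding g_def
    proof (rule convex_supp_sum[OF conv[OF that]])
      show "supp_sum (\<lambda>U. H U x) \<C> = 1"
        using H1 that by blast
      show "0 \<le> H U x \<and> (H U x = 0 \<or> \<tau> U \<in> G x)" if "U \<in> \<C>" for U
        using H[OF that] H0[OF that] \<tau>[OF that] \<open>x \<in> X\<close> by blast
    qed
  qed
qed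

text \<open>Induction on the set \<open>I\<close> of coordinates already selected. The invariant
  asks that the chosen coordinates extend to some point of \<open>F x\<close>; the values of
  \<open>f\<close> outside \<open>I\<close> are irrelevant.\<close>

lemma slice_convex_selection:
  fixes F :: "'a::{metric_space,second_countable_topology} \<Rightarrow> (real ^ 'n) set"
  assumes X: "open X"
    and graph: "open {(x, y). x \<in> X \<and> y \<in> F x}"
    and ne: "\<And>x. x \<in> X \<Longrightarrow> F x \<noteq> {}"
    and sc: "\<And>x. x \<in> X \<Longrightarrow> slice_convex (F x)"
  obtains f where "continuous_on X f" "\<And>x. x \<in> X \<Longrightarrow> f x \<in> F x"
proof -
  have "\<exists>f :: 'a \<Rightarrow> real ^ 'n. continuous_on X f \<and> (\<forall>x\<in>X. \<exists>y\<in>F x. \<forall>i\<in>I. y $ i = f x $ i)"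
    if "finite I" for I
    using that
  proof induction
    case empty
    show ?case
      using ne by (intro exI[of _ "\<lambda>x. 0"]) auto
  next
    case (insert k I)
    then obtain f :: "'a \<Rightarrow> real ^ 'n" where contf: "continuous_on X f"
      and f: "\<And>x. x \<in> X \<Longrightarrow> \<exists>y\<in>F x. \<forall>i\<in>I. y $ i = f x $ i"
      by blast
    define G where "G x = {t. \<exists>y\<in>F x. (\<forall>i\<in>I. y $ i = f x $ i) \<and> y $ k = t}" for x
    have conv: "convex (G x)" if "x \<in> X" for x
      unfolding is_interval_convex_1[symmetric] is_interval_1
    proof (intro ballI allI impI)
      fix s t c assume "s \<in> G x" "t \<in> G x" "s \<le> c \<and> c \<le> t"
      then obtain y z where y: "y \<in> F x" "\<forall>i\<in>I. y $ i = f x $ i" "y $ k \<le> c"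
        and z: "z \<in> F x" "\<forall>i\<in>I. z $ i = f x $ i" "c \<le> z $ k"
        by (auto simp: G_def)
      then obtain w where "w \<in> F x" "w $ k = c" "\<And>i. w $ i \<in> closed_segment (y $ i) (z $ i)"
        using sc[OF \<open>x \<in> X\<close>] unfolding slice_convex_def by meson
      \<comment> \<open>On \<open>I\<close> the two ends agree, so the segment shrinks to a point
        and the selected coordinates are kept.\<close>
      moreover from this have "w $ i = f x $ i" if "i \<in> I" for i
        using y(2) z(2) that by (metis closed_segment_idem singletonD)
      ultimately show "c \<in> G x"
        by (auto simp: G_def)
    qed
    have fib: "open {x \<in> X. t \<in> G x}" for t
    proof -
      \<comment> \<open>Coordinates in \<open>I\<close> follow \<open>f x\<close>, coordinate
        \<open>k\<close> is \<open>t\<close>, and the rest is frozen at \<open>y\<close>. For fixed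
        \<open>y\<close> this is continuous in \<open>x\<close>, so the open graph pulls back to an
        open set; the fibre is the union over \<open>y\<close>.\<close>
      define h :: "real ^ 'n \<Rightarrow> 'a \<Rightarrow> real ^ 'n"
        where "h y x = (\<chi> i. if i \<in> I then f x $ i else if i = k then t else y $ i)" for y x
      have "continuous_on X (\<lambda>x. (x, h y x))" for y
      proof -
        have "continuous_on X (\<lambda>x. if i \<in> I then f x $ i else if i = k then t else y $ i)" for i
          by (cases "i \<in> I"; cases "i = k") (auto intro!: continuous_intros contf)
        then show ?thesis
          unfolding h_def by (intro continuous_intros continuous_on_vec_lambda)
      qed
      then have "open (X \<inter> (\<lambda>x. (x, h y x)) -` {(x, y). x \<in> X \<and> y \<in> F x})" for y
        using X graph continuous_open_preimage by blast
      then have "open (\<Union>y. X \<inter> (\<lambda>x. (x, h y x)) -` {(x, y). x \<in> X \<and> y \<in> F x})"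
        by blast
      moreover have "{x \<in> X. t \<in> G x} = (\<Union>y. X \<inter> (\<lambda>x. (x, h y x)) -` {(x, y). x \<in> X \<and> y \<in> F x})"
      proof (intro equalityI subsetI)
        fix x assume "x \<in> {x \<in> X. t \<in> G x}"
        then obtain y where y: "x \<in> X" "y \<in> F x" "\<forall>i\<in>I. y $ i = f x $ i" "y $ k = t"
          by (auto simp: G_def)
        then have "h y x = y"
          by (auto simp: h_def vec_eq_iff)
        with y have "x \<in> X \<inter> (\<lambda>x. (x, h y x)) -` {(x, y). x \<in> X \<and> y \<in> F x}"
          by simp
        then show "x \<in> (\<Union>y. X \<inter> (\<lambda>x. (x, h y x)) -` {(x, y). x \<in> X \<and> y \<in> F x})"
          by blast
      next
        fix x assume "x \<in> (\<Union>y. X \<inter> (\<lambda>x. (x, h y x)) -` {(x, y). x \<in> X \<and> y \<in> F x})"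
        then obtain y where "x \<in> X" "h y x \<in> F x"
          by auto
        then show "x \<in> {x \<in> X. t \<in> G x}"
          using insert.hyps by (auto simp: G_def h_def intro!: bexI[of _ "h y x"])
      qed
      ultimately show ?thesis
        by simp
    qed
    have "G x \<noteq> {}" if "x \<in> X" for x
      using f[OF that] by (auto simp: G_def)
    then obtain g where contg: "continuous_on X g" and g: "\<And>x. x \<in> X \<Longrightarrow> g x \<in> G x"
      using convex_open_fibre_selection[of X G] conv fib by blast
    define f' :: "'a \<Rightarrow> real ^ 'n" where "f' x = (\<chi> i. if i = k then g x else f x $ i)" for x
    have "continuous_on X (\<lambda>x. if i = k then g x else f x $ i)" for i
      by (cases "i = k") (auto intro!: continuous_intros contf contg)
    then have "continuous_on X f'"
      unfolding f'_def by (intro continuous_on_vec_lambda)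
    moreover have "\<exists>y\<in>F x. \<forall>i\<in>insert k I. y $ i = f' x $ i" if "x \<in> X" for x
      using g[OF that] by (auto simp: G_def f'_def)
    ultimately show ?case
      by blast
  qed
  from this[of UNIV] obtain f :: "'a \<Rightarrow> real ^ 'n" where f: "continuous_on X f"
      "\<forall>x\<in>X. \<exists>y\<in>F x. \<forall>i. y $ i = f x $ i"
    by auto
  then have "f x \<in> F x" if "x \<in> X" for x
    using that by (metis vec_eq_iff)
  with f(1) that show ?thesis
    by blast
qed

section \<open>Improving an approximation\<close>

text \<open>Select from the \<open>\<sigma> x\<close>-thickening of \<open>A\<close> cut by the
  \<open>\<rho> x\<close>-cube around \<open>f x\<close>. The point of \<open>A\<close> supplied by
  \<open>near\<close> lies in both.\<close>

lemma slice_convex_approximation_step: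
  fixes A :: "(real ^ 'n) set" and X :: "'a::{metric_space,second_countable_topology} set"
  assumes A: "slice_convex A" and X: "open X"
    and f: "continuous_on X f" and \<rho>: "continuous_on X \<rho>" and \<sigma>: "continuous_on X \<sigma>"
    and pos: "\<And>x. x \<in> X \<Longrightarrow> 0 < \<sigma> x"
    and near: "\<And>x. x \<in> X \<Longrightarrow> \<exists>a\<in>A. \<forall>i. \<bar>f x $ i - a $ i\<bar> < \<rho> x"
  obtains g where "continuous_on X g"
    "\<And>x. x \<in> X \<Longrightarrow> \<exists>a\<in>A. \<forall>i. \<bar>g x $ i - a $ i\<bar> < \<sigma> x"
    "\<And>x i. x \<in> X \<Longrightarrow> \<bar>g x $ i - f x $ i\<bar> < \<rho> x"
proof -
  define F where "F x = {y. \<exists>a\<in>A. \<forall>i. \<bar>y $ i - a $ i\<bar> < \<sigma> x} \<inter> {y. \<forall>i. \<bar>y $ i - f x $ i\<bar> < \<rho> x}"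
    for x
  have fst: "continuous_on (X \<times> UNIV) (\<lambda>p. q (fst p))" if "continuous_on X q"
    for q :: "'a \<Rightarrow> 'c::topological_space"
    by (rule continuous_on_compose2[OF that continuous_on_fst[OF continuous_on_id]]) auto
  have XU: "open (X \<times> (UNIV :: (real ^ 'n) set))"
    using X by (simp add: open_Times)
  \<comment> \<open>The graph is assembled from strict inequalities, one per coordinate; the
    intersections are finite because the index type is.\<close>
  define D where "D a i = (X \<times> UNIV) \<inter> (\<lambda>p. \<sigma> (fst p) - \<bar>snd p $ i - a $ i\<bar>) -` {0<..}"
    for a :: "real ^ 'n" and i
  define E where "E i = (X \<times> UNIV) \<inter> (\<lambda>p. \<rho> (fst p) - \<bar>snd p $ i - f (fst p) $ i\<bar>) -` {0<..}"
    for i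
  have "open (D a i)" for a i
    unfolding D_def
    by (intro continuous_open_preimage XU open_greaterThan continuous_intros fst \<sigma>)
  moreover have "open (E i)" for i
    unfolding E_def
    by (intro continuous_open_preimage XU open_greaterThan continuous_intros fst \<rho> f)
  moreover have "{(x, y). x \<in> X \<and> y \<in> F x} = (\<Union>a\<in>A. \<Inter>i. D a i) \<inter> (\<Inter>i. E i)"
    by (auto simp: F_def D_def E_def) blast
  ultimately have graph: "open {(x, y). x \<in> X \<and> y \<in> F x}"
    by (auto intro!: open_Int open_UN open_INT)
  have ne: "F x \<noteq> {}" if x: "x \<in> X" for x
  proof -
    obtain a where "a \<in> A" "\<And>i. \<bar>f x $ i - a $ i\<bar> < \<rho> x"
      using near[OF x] by blast
    then have "a \<in> F x"
      using pos[OF x] by (auto simp: F_def abs_minus_commute intro!: bexI[of _ a])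
    then show ?thesis
      by blast
  qed
  have "slice_convex (F x)" for x
    unfolding F_def by (intro slice_convex_Int_cube slice_convex_thicken A)
  then obtain g where "continuous_on X g" "\<And>x. x \<in> X \<Longrightarrow> g x \<in> F x"
    using slice_convex_selection[OF X graph ne] by blast
  then show ?thesis
    by (intro that[of g]) (auto simp: F_def)
qed

section \<open>Construction of the retraction\<close>

text \<open>Scaling every error by the distance to \<open>A\<close> bounds the total displacement by
  a constant times that distance, which gives continuity at the points of \<open>A\<close>.\<close>

lemma slice_convex_closed_retract:
  fixes A :: "(real ^ 'n) set"
  assumes ne: "A \<noteq> {}" and cl: "closed A" and A: "slice_convex A"
  shows "A retract_of UNIV"
proof -
  define X where "X = - A"
  \<comment> \<open>The factor 2 makes the initial estimate strict: a nearest point is at distance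
    \<open>\<rho> x / 2\<close>.\<close>
  define \<rho> where "\<rho> x = 2 * infdist x A" for x
  have X: "open X"
    using cl by (simp add: X_def open_Compl)
  have pos: "0 < \<rho> x" if "x \<in> X" for x
    using infdist_pos_not_in_closed[OF cl ne] that by (auto simp: \<rho>_def X_def)
  have cont\<rho>: "continuous_on S \<rho>" for S
    unfolding \<rho>_def by (intro continuous_intros)
  have cont\<rho>j: "continuous_on X (\<lambda>x. \<rho> x / 2 ^ j)" for j :: nat
    by (intro continuous_intros cont\<rho>) auto
  define P where "P j f \<longleftrightarrow> continuous_on X f \<and>
      (\<forall>x\<in>X. \<exists>a\<in>A. \<forall>i. \<bar>f x $ i - a $ i\<bar> < \<rho> x / 2 ^ j)"
    for j :: nat and f :: "real ^ 'n \<Rightarrow> real ^ 'n"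
  define Q where "Q j f g \<longleftrightarrow> (\<forall>x\<in>X. \<forall>i. \<bar>g x $ i - f x $ i\<bar> < \<rho> x / 2 ^ j)"
    for j :: nat and f g :: "real ^ 'n \<Rightarrow> real ^ 'n"
  have P0: "P 0 (\<lambda>x. x)"
    unfolding P_def
  proof (intro conjI ballI)
    fix x assume x: "x \<in> X"
    obtain a where a: "a \<in> A" "infdist x A = dist x a"
      using infdist_attains_inf[OF cl ne] by blast
    have "\<bar>x $ i - a $ i\<bar> < \<rho> x / 2 ^ 0" for i
      using component_le_norm_cart[of "x - a" i] a(2) pos[OF x] by (auto simp: \<rho>_def dist_norm simp del: zero_less_norm_iff)
    with a show "\<exists>a\<in>A. \<forall>i. \<bar>x $ i - a $ i\<bar> < \<rho> x / 2 ^ 0"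
      by blast
  qed (rule continuous_on_id)
  have "\<exists>g. P (Suc j) g \<and> Q j f g" if f: "P j f" for j f
  proof -
    have "\<And>x. x \<in> X \<Longrightarrow> 0 < \<rho> x / 2 ^ Suc j"
      using pos by simp
    with f show ?thesis
      using slice_convex_approximation_step[OF A X _ cont\<rho>j[of j] cont\<rho>j[of "Suc j"], of f]
      unfolding P_def Q_def by metis
  qed
  \<comment> \<open>Dependent choice; the clause for \<open>j = 0\<close> pins the start to the
    identity.\<close>
  then obtain r where r: "\<And>j. P j (r j)" "\<And>j. Q j (r j) (r (Suc j))" and r0: "r 0 = (\<lambda>x. x)"
    using dependent_nat_choice[of "\<lambda>j f. P j f \<and> (j = 0 \<longrightarrow> f = (\<lambda>x. x))" Q] P0 by fastforce

  text \<open>Dividing the increments by \<open>\<rho> x\<close> makes their series converge uniformly, although \<open>\<rho>\<close> is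
    unbounded.\<close>
  define c where "c j x = (r (Suc j) x - r j x) /\<^sub>R \<rho> x" for j x
  \<comment> \<open>The factor \<open>CARD('n)\<close> comes from bounding the Euclidean norm by the
    sum of the coordinates' absolute values.\<close>
  define M where "M j = real CARD('n) * (1/2) ^ j" for j
  have norm_c: "norm (c j x) \<le> M j" if x: "x \<in> X" for j x
  proof -
    have "norm (r (Suc j) x - r j x) \<le> (\<Sum>i\<in>UNIV. \<bar>(r (Suc j) x - r j x) $ i\<bar>)"
      by (rule norm_le_l1_cart)
    also have "\<dots> \<le> (\<Sum>i\<in>(UNIV::'n set). \<rho> x / 2 ^ j)"
      using r(2)[of j] x by (intro sum_mono) (auto simp: Q_def less_imp_le)
    finally show ?thesis
      using pos[OF x] by (simp add: c_def M_def divide_simps mult.commute)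
  qed
  have sumM: "summable M" and M2: "(\<Sum>j. M j) = 2 * real CARD('n)"
    unfolding M_def by (simp_all add: summable_geometric suminf_mult suminf_geometric)
  define s where "s x = (\<Sum>j. c j x)" for x
  have lim: "uniform_limit X (\<lambda>n x. \<Sum>j<n. c j x) s sequentially"
    unfolding s_def by (rule Weierstrass_m_test[OF norm_c sumM])
  have "continuous_on X (\<lambda>x. \<Sum>j<n. c j x)" for n
    unfolding c_def using r(1) pos
    by (intro continuous_intros cont\<rho>) (auto simp: P_def less_le)
  then have conts: "continuous_on X s"
    by (intro uniform_limit_theorem[OF _ lim]) auto
  have norm_s: "norm (s x) \<le> 2 * real CARD('n)" if "x \<in> X" for x
    unfolding s_def M2[symmetric] using norm_c[OF that] sumM by (intro norm_suminf_le) auto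
  define R where "R x = x + \<rho> x *\<^sub>R s x" for x
  have RA: "R x = x" if "x \<in> A" for x
    using that by (simp add: R_def \<rho>_def)
  have RX: "R x \<in> A" if x: "x \<in> X" for x
  proof -
    \<comment> \<open>The increments telescope, so \<open>R x\<close> is the limit of
      \<open>r n x\<close>.\<close>
    have "(\<Sum>j<n. c j x) = (r n x - x) /\<^sub>R \<rho> x" for n
      by (induction n) (simp_all add: r0 c_def algebra_simps)
    then have "r n x = x + \<rho> x *\<^sub>R (\<Sum>j<n. c j x)" for n
      using pos[OF x] by simp
    moreover have "(\<lambda>n. \<Sum>j<n. c j x) \<longlonglongrightarrow> s x"
      by (rule tendsto_uniform_limitI[OF lim x])
    ultimately have "(\<lambda>n. r n x) \<longlonglongrightarrow> R x"
      unfolding R_def by (auto intro!: tendsto_intros)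
    then have "(\<lambda>n. infdist (r n x) A) \<longlonglongrightarrow> infdist (R x) A"
      by (rule tendsto_infdist)
    moreover have "(\<lambda>n. infdist (r n x) A) \<longlonglongrightarrow> 0"
    proof (rule tendsto_sandwich[OF _ _ tendsto_const])
      have "infdist (r n x) A \<le> \<rho> x * M n" for n
      proof -
        obtain a where a: "a \<in> A" "\<And>i. \<bar>r n x $ i - a $ i\<bar> < \<rho> x / 2 ^ n"
          using r(1)[of n] x by (auto simp: P_def)
        have "infdist (r n x) A \<le> norm (r n x - a)"
          using infdist_le[OF a(1)] by (simp add: dist_norm)
        also have "\<dots> \<le> (\<Sum>i\<in>UNIV. \<bar>(r n x - a) $ i\<bar>)"
          by (rule norm_le_l1_cart)
        also have "\<dots> \<le> (\<Sum>i\<in>(UNIV::'n set). \<rho> x / 2 ^ n)"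
          using a(2) by (intro sum_mono) (auto simp: less_imp_le)
        finally show ?thesis
          by (simp add: M_def divide_simps mult.commute)
      qed
      then show "\<forall>\<^sub>F n in sequentially. infdist (r n x) A \<le> \<rho> x * M n"
        by simp
      show "(\<lambda>n. \<rho> x * M n) \<longlonglongrightarrow> 0"
        using tendsto_mult_left[OF summable_LIMSEQ_zero[OF sumM], of "\<rho> x"] by simp
    qed (simp add: infdist_nonneg)
    ultimately have "infdist (R x) A = 0"
      using LIMSEQ_unique by blast
    then show ?thesis
      using in_closed_iff_infdist_zero[OF cl ne] by blast
  qed
  have "isCont R x" for x
  proof (cases "x \<in> X")
    case True
    have "continuous_on X R"
      unfolding R_def by (intro continuous_intros cont\<rho> conts)
    then show ?thesis
      using True X continuous_on_eq_continuous_at by blast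
  next
    case False
    then have x: "x \<in> A"
      by (simp add: X_def)
    \<comment> \<open>Since \<open>x\<close> is in \<open>A\<close>, \<open>\<rho> y\<close> is at
      most twice \<open>norm (y - x)\<close>; with the bound on \<open>s\<close> this yields the
      constant 4.\<close>
    have bound: "norm (R y - R x) \<le> (1 + 4 * real CARD('n)) * norm (y - x)" for y
    proof (cases "y \<in> X")
      case True
      have "R y - R x = (y - x) + \<rho> y *\<^sub>R s y"
        unfolding RA[OF x] by (simp add: R_def)
      then have "norm (R y - R x) \<le> norm (y - x) + \<rho> y * norm (s y)"
        using norm_triangle_ineq[of "y - x" "\<rho> y *\<^sub>R s y"] pos[OF True] by simp
      also have "\<rho> y * norm (s y) \<le> (2 * norm (y - x)) * (2 * real CARD('n))"
        using infdist_le[OF x, of y] norm_s[OF True] pos[OF True]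
        by (intro mult_mono) (auto simp: \<rho>_def dist_norm)
      finally show ?thesis
        by (simp add: algebra_simps)
    next
      case False
      then show ?thesis
        using RA[OF x] RA[of y] by (simp add: X_def algebra_simps)
    qed
    have "((\<lambda>y. (1 + 4 * real CARD('n)) * norm (y - x)) \<longlongrightarrow> 0) (at x)"
      by (rule tendsto_eq_intros refl | simp)+
    then have "((\<lambda>y. R y - R x) \<longlongrightarrow> 0) (at x)"
      by (rule Lim_null_comparison[rotated]) (simp add: bound)
    then show ?thesis
      by (simp add: isCont_def LIM_zero_iff)
  qed
  then have "continuous_on UNIV R"
    by (simp add: continuous_on_eq_continuous_at)
  moreover have "R x \<in> A" for x
    using RX RA[of x] by (cases "x \<in> A") (auto simp: X_def)
  ultimately show ?thesis
    using RA unfolding retract_of_def retraction_def by blast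
qed

theorem theorem2:
  fixes A :: "(real ^ 'n) set"
  assumes "A \<noteq> {}" and "closed A" and "monovex A"
  shows "contractible A"
  using slice_convex_closed_retract[OF assms(1,2) monovex_imp_slice_convex[OF assms(3)]]
  by (rule retract_of_contractible[OF contractible_UNIV])

end
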